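(* Let $\kappa\in\mathbb{R}$, $\kappa\neq 0$, let $n\geq 3$, and let $m_{1},\dots,m_{n}>0$. Consider the curved $n$-body problem on $\mathbf{M}_{\kappa}^{2}$ with masses $m_1,\dots,m_n$, i.e. the system $$\ddot{\mathbf{q}}_{i}=\sum_{j=1,\, j\neq i}^{n}\frac{m_{j}|\kappa|^{3/2}\left[\mathbf{q}_{j}-(\kappa\,\mathbf{q}_{i}\odot\mathbf{q}_{j})\mathbf{q}_{i}\right]}{\left[\sigma-\sigma(\kappa\,\mathbf{q}_{i}\odot\mathbf{q}_{j})^{2}\right]^{3/2}}-(\kappa\,\dot{\mathbf{q}}_{i}\odot\dot{\mathbf{q}}_{i})\mathbf{q}_{i},\qquad i=1,\dots,n.$$ This system admits no polygonal homographic orbit whose polygon is irregular and whose height function $z$ is not constant. That is, there is no solution $\mathbf{q}=(\mathbf{q}_1,\dots,\mathbf{q}_n)$ on a time interval of the form $$\mathbf{q}_i(t)=\bigl(r(t)\cos(\omega(t)+\alpha_i),\; r(t)\sin(\omega(t)+\alpha_i),\; z(t)\bigr),\qquad i=1,\dots,n,$$ with constants $0\leq\alpha_{1}<\alpha_{2}<\dots<\alpha_{n}<2\pi$ and with $z(t)^{2}=\sigma\kappa^{-1}-\sigma r(t)^{2}$, such that the polygon with vertices $\mathbf{q}_1,\dots,\mathbf{q}_n$ is not regular and the function $z$ is not constant.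
   Context: For $\kappa\neq 0$ put $\sigma=1$ if $\kappa>0$ and $\sigma=-1$ if $\kappa<0$. For $\mathbf{a}=(a_x,a_y,a_z)$, $\mathbf{b}=(b_x,b_y,b_z)\in\mathbb{R}^3$ define $\mathbf{a}\odot\mathbf{b}=a_xb_x+a_yb_y+\sigma a_zb_z$. Define $\mathbf{M}_{\kappa}^{2}=\{(x,y,z)\in\mathbb{R}^{3}\mid \kappa(x^{2}+y^{2}+\sigma z^{2})=1\}$. The $n$ point particles have masses $m_i>0$ and positions $\mathbf{q}_i=(x_i,y_i,z_i)\in\mathbf{M}_{\kappa}^{2}$; dots denote time derivatives. A solution is a twice differentiable function of $t$ on a (nondegenerate) time interval satisfying the equations of motion at each time, so in particular the denominators do not vanish along it. A polygonal homographic orbit (or polygonal homographic solution) is a solution of the equations of motion of the form $x_i=r\cos(\omega+\alpha_i)$, $y_i=r\sin(\omega+\alpha_i)$, $z_i=z$ for $i=1,\dots,n$, where $0\leq\alpha_{1}<\dots<\alpha_{n}<2\pi$ are constants, $r=r(t)$ is the size function, $\omega=\omega(t)$ is the angular function, and $z=z(t)$ satisfies $z^{2}=\sigma\kappa^{-1}-\sigma r^{2}$. With the convention $\alpha_{n+1}:=\alpha_1+2\pi$, the polygon is regular if $\alpha_{i+1}-\alpha_i=2\pi/n$ for all $i\in\{1,\dots,n\}$, and irregular otherwise. *)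

theory Defs
  imports "HOL-Analysis.Analysis"
begin

definition curv_sign :: "real \<Rightarrow> real" where
  "curv_sign \<kappa> = (if \<kappa> > 0 then 1 else - 1)"

definition odot :: "real \<Rightarrow> real ^ 3 \<Rightarrow> real ^ 3 \<Rightarrow> real" where
  "odot \<kappa> a b = a $ 1 * b $ 1 + a $ 2 * b $ 2 + curv_sign \<kappa> * (a $ 3 * b $ 3)"

definition curved_surface :: "real \<Rightarrow> (real ^ 3) set" where
  "curved_surface \<kappa> =
     {p. \<kappa> * ((p $ 1)\<^sup>2 + (p $ 2)\<^sup>2 + curv_sign \<kappa> * (p $ 3)\<^sup>2) = 1}"

text \<open>For two points of the surface the base of this power is nonnegative, so \<open>powr\<close>
  is the usual power here.\<close>

definition force_denominator :: "real \<Rightarrow> real ^ 3 \<Rightarrow> real ^ 3 \<Rightarrow> real" where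
  "force_denominator \<kappa> a b =
     (curv_sign \<kappa> - curv_sign \<kappa> * (\<kappa> * odot \<kappa> a b)\<^sup>2) powr (3 / 2)"

definition curved_acceleration ::
    "real \<Rightarrow> nat \<Rightarrow> (nat \<Rightarrow> real) \<Rightarrow> (nat \<Rightarrow> real ^ 3) \<Rightarrow> (nat \<Rightarrow> real ^ 3) \<Rightarrow> nat \<Rightarrow> real ^ 3" where
  "curved_acceleration \<kappa> n m p v i =
     (\<Sum>j\<in>{1..n} - {i}.
        (m j * \<bar>\<kappa>\<bar> powr (3 / 2) / force_denominator \<kappa> (p i) (p j)) *\<^sub>R
          (p j - (\<kappa> * odot \<kappa> (p i) (p j)) *\<^sub>R p i))
     - (\<kappa> * odot \<kappa> (v i) (v i)) *\<^sub>R p i"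

text \<open>\<open>q i t\<close> is the position of particle \<open>i \<in> {1..n}\<close> at time \<open>t\<close>. The time interval \<open>T\<close> may
  be open, closed or half-open, bounded or not; derivatives at an endpoint belonging to \<open>T\<close> are
  one-sided. As \<open>T\<close> is nondegenerate, the velocities \<open>v i t\<close> are unique. Division by zero is
  total in HOL, so nonvanishing of the denominators is required explicitly.\<close>

definition curved_nbody_solution ::
    "real \<Rightarrow> nat \<Rightarrow> (nat \<Rightarrow> real) \<Rightarrow> real set \<Rightarrow> (nat \<Rightarrow> real \<Rightarrow> real ^ 3) \<Rightarrow> bool" where
  "curved_nbody_solution \<kappa> n m T q \<longleftrightarrow>
     is_interval T \<and> (\<exists>a\<in>T. \<exists>b\<in>T. a < b) \<and>
     (\<forall>t\<in>T. \<forall>i\<in>{1..n}. q i t \<in> curved_surface \<kappa>) \<and>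
     (\<forall>t\<in>T. \<forall>i\<in>{1..n}. \<forall>j\<in>{1..n} - {i}. force_denominator \<kappa> (q i t) (q j t) \<noteq> 0) \<and>
     (\<exists>v. \<forall>t\<in>T. \<forall>i\<in>{1..n}.
        (q i has_vector_derivative v i t) (at t within T) \<and>
        (v i has_vector_derivative
           curved_acceleration \<kappa> n m (\<lambda>j. q j t) (\<lambda>j. v j t) i) (at t within T))"

text \<open>No sign or regularity is imposed on the size, angular and height functions
  \<open>r\<close>, \<open>\<omega>\<close>, \<open>z\<close> beyond what follows from \<open>q\<close> being a solution.\<close>

definition polygonal_homographic_orbit ::
    "real \<Rightarrow> nat \<Rightarrow> (nat \<Rightarrow> real) \<Rightarrow> real set \<Rightarrow> (nat \<Rightarrow> real \<Rightarrow> real ^ 3) \<Rightarrow>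
     (real \<Rightarrow> real) \<Rightarrow> (real \<Rightarrow> real) \<Rightarrow> (real \<Rightarrow> real) \<Rightarrow> (nat \<Rightarrow> real) \<Rightarrow> bool" where
  "polygonal_homographic_orbit \<kappa> n m T q r \<omega> z \<alpha> \<longleftrightarrow>
     curved_nbody_solution \<kappa> n m T q \<and>
     (\<forall>i\<in>{1..n}. 0 \<le> \<alpha> i \<and> \<alpha> i < 2 * pi) \<and> strict_mono_on {1..n} \<alpha> \<and>
     (\<forall>t\<in>T. \<forall>i\<in>{1..n}.
        q i t = vector [r t * cos (\<omega> t + \<alpha> i), r t * sin (\<omega> t + \<alpha> i), z t]) \<and>
     (\<forall>t\<in>T. (z t)\<^sup>2 = curv_sign \<kappa> * inverse \<kappa> - curv_sign \<kappa> * (r t)\<^sup>2)"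

definition regular_polygon :: "nat \<Rightarrow> (nat \<Rightarrow> real) \<Rightarrow> bool" where
  "regular_polygon n \<alpha> \<longleftrightarrow>
     (\<forall>i\<in>{1..n}. (if i = n then \<alpha> 1 + 2 * pi else \<alpha> (i + 1)) - \<alpha> i = 2 * pi / real n)"

end

theory Submission
  imports Defs
begin

text \<open>The obstruction is the torque about the \<open>z\<close>-axis. The configuration rotates and dilates as a
  whole, so the specific torque \<open>x y'' - y x''\<close> is the same for every particle; the forces are
  pairwise antisymmetric, so the mass-weighted sum of these torques vanishes. Hence each particle
  separately feels no torque. With \<open>\<rho> = r\<^sup>2\<close> and \<open>d\<^sub>i\<^sub>j = 1 - cos (\<alpha>\<^sub>j - \<alpha>\<^sub>i)\<close> this reads
  \<open>\<Sum>\<^sub>j m\<^sub>j sin (\<alpha>\<^sub>j - \<alpha>\<^sub>i) / (d\<^sub>i\<^sub>j (2 - \<rho> \<kappa> d\<^sub>i\<^sub>j)) powr (3/2) = 0\<close>, up to a positive factor depending on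
  \<open>\<rho>\<close> alone (lemma \<open>torque_zero\<close>).

  If the height \<open>z\<close> is not constant, then \<open>\<rho>\<close> takes all values of an interval. The functions
  \<open>\<rho> \<mapsto> (2 - \<rho> \<kappa> d) powr (- 3/2)\<close> with distinct \<open>d\<close> are linearly independent there
  (lemma \<open>shifted_powers_independent\<close>), so the torques exerted on particle \<open>i\<close> cancel among the
  particles at each single distance from it (lemma \<open>torque_balances_at_each_distance\<close>). At most two
  points of a circle lie at a given distance from \<open>i\<close>, one on each side, and the masses are positive.
  So the mirror image of every vertex in the axis through vertex \<open>i\<close> is again a vertex, unless the
  vertex lies on the axis.

  Consequently, a gap less than \<open>\<pi>\<close> is mirrored to the other side of its first vertex and bounds
  the preceding gap. A gap larger than the average \<open>2 \<pi> / n < \<pi>\<close> would therefore force the next gap,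
  and so every gap, to exceed the average, which is absurd. All gaps are equal to the average, and the
  polygon is regular (lemma \<open>mirror_vertices_imp_regular\<close>).\<close>

section \<open>Linear independence of powers of affine functions\<close>

text \<open>Vanishing moments annihilate all polynomials, in particular the one that vanishes at every
  node other than \<open>y\<close>.\<close>

lemma moments_zero_imp_fibre_sum_zero:
  fixes C x :: "'a \<Rightarrow> real"
  assumes J: "finite J" and mom: "\<And>k::nat. (\<Sum>j\<in>J. C j * x j ^ k) = 0"
  shows "(\<Sum>j\<in>{j\<in>J. x j = y}. C j) = 0"
proof -
  have poly0: "(\<Sum>j\<in>J. C j * poly p (x j)) = 0" for p
  proof -
    have "(\<Sum>j\<in>J. C j * poly p (x j)) = (\<Sum>j\<in>J. \<Sum>k\<le>degree p. coeff p k * (C j * x j ^ k))"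
      by (simp add: poly_altdef sum_distrib_left mult_ac)
    also have "\<dots> = (\<Sum>k\<le>degree p. coeff p k * (\<Sum>j\<in>J. C j * x j ^ k))"
      by (subst sum.swap) (simp add: sum_distrib_left)
    finally show ?thesis using mom by simp
  qed
  define p where "p = (\<Prod>e\<in>x ` J - {y}. [:- e, 1:])"
  have py: "poly p y \<noteq> 0" and px: "\<And>j. j \<in> J \<Longrightarrow> x j \<noteq> y \<Longrightarrow> poly p (x j) = 0"
    using J by (auto simp: p_def poly_prod)
  have "(\<Sum>j\<in>J. C j * poly p (x j)) = (\<Sum>j\<in>{j\<in>J. x j = y}. C j * poly p (x j))"
    using J px by (intro sum.mono_neutral_right) auto
  also have "\<dots> = poly p y * (\<Sum>j\<in>{j\<in>J. x j = y}. C j)"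
    by (simp add: sum_distrib_left mult.commute)
  finally show ?thesis using poly0[of p] py by simp
qed

text \<open>Differentiating \<open>k\<close> times multiplies the summand for \<open>j\<close> by \<open>(e\<^sub>j / (c - \<rho> e\<^sub>j))^k\<close>, up to a factor that
  does not depend on \<open>j\<close> and is nonzero because \<open>s < 0\<close>. At a fixed \<open>\<rho>\<close> these are vanishing moments
  with nodes \<open>e\<^sub>j / (c - \<rho> e\<^sub>j)\<close>, which determine \<open>e\<^sub>j\<close> as \<open>c \<noteq> 0\<close>.\<close>

lemma shifted_powers_independent:
  fixes C e :: "'a \<Rightarrow> real"
  assumes J: "finite J" and ab: "a < b" and c: "c \<noteq> 0" and s: "s < 0"
    and pos: "\<And>j \<rho>. j \<in> J \<Longrightarrow> a < \<rho> \<Longrightarrow> \<rho> < b \<Longrightarrow> c - \<rho> * e j > 0"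
    and zero: "\<And>\<rho>. a < \<rho> \<Longrightarrow> \<rho> < b \<Longrightarrow> (\<Sum>j\<in>J. C j * (c - \<rho> * e j) powr s) = 0"
  shows "(\<Sum>j\<in>{j\<in>J. e j = y}. C j) = 0"
proof (cases "\<exists>j\<in>J. e j = y")
  case False
  then have "{j\<in>J. e j = y} = {}" by auto
  then show ?thesis by (metis sum.empty)
next
  case True
  have deriv: "(\<Sum>j\<in>J. C j * e j ^ k * (c - \<rho> * e j) powr (s - real k)) = 0"
    if "a < \<rho>" "\<rho> < b" for k \<rho>
    using that
  proof (induction k arbitrary: \<rho>)
    case 0
    then show ?case using zero by simp
  next
    case (Suc k)
    let ?f = "\<lambda>\<rho>. \<Sum>j\<in>J. C j * e j ^ k * (c - \<rho> * e j) powr (s - real k)"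
    have "(?f has_real_derivative
        (\<Sum>j\<in>J. C j * e j ^ k * ((s - real k) * (c - \<rho> * e j) powr (s - real k - 1) * - e j))) (at \<rho>)"
    proof (intro DERIV_sum DERIV_cmult)
      fix j assume j: "j \<in> J"
      have "((\<lambda>\<rho>. c - \<rho> * e j) has_real_derivative - e j) (at \<rho>)"
        by (auto intro!: derivative_eq_intros)
      from DERIV_fun_powr[OF this pos[OF j Suc.prems], of "s - real k"]
      show "((\<lambda>\<rho>. (c - \<rho> * e j) powr (s - real k)) has_real_derivative
          (s - real k) * (c - \<rho> * e j) powr (s - real k - 1) * - e j) (at \<rho>)"
        by simp
    qed
    moreover have "(?f has_real_derivative 0) (at \<rho>)"
    proof (rule has_field_derivative_transform_within_open)
      show "((\<lambda>_. 0) has_real_derivative 0) (at \<rho>)" by simp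
      show "open {a<..<b}" "\<rho> \<in> {a<..<b}" using Suc.prems by auto
      show "0 = ?f x" if "x \<in> {a<..<b}" for x using Suc.IH[of x] that by simp
    qed
    ultimately have "0 = (\<Sum>j\<in>J. C j * e j ^ k *
        ((s - real k) * (c - \<rho> * e j) powr (s - real k - 1) * - e j))"
      using DERIV_unique by blast
    also have "\<dots> = (real k - s) *
        (\<Sum>j\<in>J. C j * e j ^ Suc k * (c - \<rho> * e j) powr (s - real (Suc k)))"
      unfolding sum_distrib_left
      by (intro sum.cong refl) (simp add: algebra_simps)
    finally show ?case using s by simp
  qed
  define \<rho> where "\<rho> = (a + b) / 2"
  have \<rho>: "a < \<rho>" "\<rho> < b" using ab by (auto simp: \<rho>_def)
  define x where "x j = e j / (c - \<rho> * e j)" for j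
  have "(\<Sum>j\<in>J. (C j * (c - \<rho> * e j) powr s) * x j ^ k) = 0" for k
  proof -
    have "(\<Sum>j\<in>J. (C j * (c - \<rho> * e j) powr s) * x j ^ k)
        = (\<Sum>j\<in>J. C j * e j ^ k * (c - \<rho> * e j) powr (s - real k))"
      using pos[OF _ \<rho>]
      by (intro sum.cong refl)
        (simp add: x_def powr_diff powr_realpow power_divide)
    then show ?thesis using deriv[OF \<rho>] by simp
  qed
  from moments_zero_imp_fibre_sum_zero[OF J this, where y = "y / (c - \<rho> * y)"]
  have 1: "(\<Sum>j\<in>{j\<in>J. x j = y / (c - \<rho> * y)}. C j * (c - \<rho> * e j) powr s) = 0" .
  have ypos: "c - \<rho> * y > 0" using True pos[OF _ \<rho>] by auto
  have "x j = y / (c - \<rho> * y) \<longleftrightarrow> e j = y" if "j \<in> J" for j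
  proof -
    have "x j = y / (c - \<rho> * y) \<longleftrightarrow> e j * (c - \<rho> * y) - y * (c - \<rho> * e j) = 0"
      using pos[OF that \<rho>] ypos by (simp add: x_def frac_eq_eq)
    also have "e j * (c - \<rho> * y) - y * (c - \<rho> * e j) = c * (e j - y)"
      by (simp add: algebra_simps)
    finally show ?thesis using c by simp
  qed
  then have "{j\<in>J. x j = y / (c - \<rho> * y)} = {j\<in>J. e j = y}" by auto
  with 1 have "(\<Sum>j\<in>{j\<in>J. e j = y}. C j * (c - \<rho> * e j) powr s) = 0" by simp
  also have "(\<Sum>j\<in>{j\<in>J. e j = y}. C j * (c - \<rho> * e j) powr s)
      = (c - \<rho> * y) powr s * (\<Sum>j\<in>{j\<in>J. e j = y}. C j)"
    by (simp add: sum_distrib_left mult.commute)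
  finally show ?thesis using ypos by simp
qed

section \<open>The torque on each particle vanishes\<close>

definition rotate_xy :: "real \<Rightarrow> real ^ 3 \<Rightarrow> real ^ 3" where
  "rotate_xy \<theta> u = vector [cos \<theta> * u $ 1 - sin \<theta> * u $ 2, sin \<theta> * u $ 1 + cos \<theta> * u $ 2, u $ 3]"

text \<open>The \<open>z\<close>-component of the vector product of \<open>p\<close> and \<open>f\<close>; the homographic rotation is about this axis.\<close>

definition torque :: "real ^ 3 \<Rightarrow> real ^ 3 \<Rightarrow> real" where
  "torque p f = p $ 1 * f $ 2 - p $ 2 * f $ 1"

lemma bounded_linear_rotate_xy: "bounded_linear (rotate_xy \<theta>)"
  unfolding linear_conv_bounded_linear[symmetric]
  by (rule linearI) (simp_all add: rotate_xy_def vec_eq_iff forall_3 algebra_simps)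

lemma torque_rotate_xy: "torque (rotate_xy \<theta> p) (rotate_xy \<theta> f) = torque p f"
proof -
  have "torque (rotate_xy \<theta> p) (rotate_xy \<theta> f) = ((cos \<theta>)\<^sup>2 + (sin \<theta>)\<^sup>2) * torque p f"
    unfolding torque_def rotate_xy_def by (simp only: vector_3) algebra
  then show ?thesis by simp
qed

lemma rotate_xy_vertex:
  "rotate_xy \<theta> (vector [r * cos \<phi>, r * sin \<phi>, z]) = vector [r * cos (\<phi> + \<theta>), r * sin (\<phi> + \<theta>), z]"
  by (simp add: rotate_xy_def cos_add sin_add algebra_simps)

lemma torque_vertices:
  "torque (vector [r * cos \<phi>, r * sin \<phi>, z]) (vector [r * cos \<psi>, r * sin \<psi>, z'])
     = r\<^sup>2 * sin (\<psi> - \<phi>)"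
  by (simp add: torque_def sin_diff power2_eq_square algebra_simps)

text \<open>The terms of the acceleration that keep the particle on the surface are multiples of its position
  and exert no torque.\<close>

lemma torque_curved_acceleration:
  "torque (p i) (curved_acceleration \<kappa> n m p v i) =
     (\<Sum>j\<in>{1..n} - {i}. m j * \<bar>\<kappa>\<bar> powr (3 / 2) / force_denominator \<kappa> (p i) (p j) * torque (p i) (p j))"
  unfolding curved_acceleration_def torque_def
  by (simp add: sum_distrib_left sum_subtractf[symmetric] algebra_simps)

text \<open>The rotation taking particle \<open>i\<close> to particle \<open>j\<close> is constant in time, so it also maps the
  velocity and the acceleration of \<open>i\<close> to those of \<open>j\<close>, and both have the same torque. The
  mass-weighted sum of the torques is zero because mutual torques cancel in pairs, so the common
  value is zero. Arguing with the rotation differentiates only the positions, whereas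
  \<open>\<omega>\<close> may jump by multiples of \<open>2 \<pi>\<close>.\<close>

lemma torque_zero:
  assumes orbit: "polygonal_homographic_orbit \<kappa> n m T q r \<omega> z \<alpha>"
    and m: "\<forall>i\<in>{1..n}. m i > 0" and k: "\<kappa> \<noteq> 0"
    and t: "t \<in> T" and i: "i \<in> {1..n}" and r0: "r t \<noteq> 0"
  shows "(\<Sum>j\<in>{1..n} - {i}. m j * sin (\<alpha> j - \<alpha> i) / force_denominator \<kappa> (q i t) (q j t)) = 0"
proof -
  from orbit have sol: "curved_nbody_solution \<kappa> n m T q"
    and q: "\<And>t i. t \<in> T \<Longrightarrow> i \<in> {1..n} \<Longrightarrow>
        q i t = vector [r t * cos (\<omega> t + \<alpha> i), r t * sin (\<omega> t + \<alpha> i), z t]"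
    by (auto simp: polygonal_homographic_orbit_def)
  note sol = sol[unfolded curved_nbody_solution_def]
  have T: "is_interval T" "\<exists>a\<in>T. \<exists>b\<in>T. a < b" using sol by blast+
  obtain v where va: "\<forall>t\<in>T. \<forall>i\<in>{1..n}.
      (q i has_vector_derivative v i t) (at t within T) \<and>
      (v i has_vector_derivative
         curved_acceleration \<kappa> n m (\<lambda>j. q j t) (\<lambda>j. v j t) i) (at t within T)"
    using sol by (elim conjE exE) (rule that)
  have v: "(q i has_vector_derivative v i t) (at t within T)"
    and a: "(v i has_vector_derivative
      curved_acceleration \<kappa> n m (\<lambda>j. q j t) (\<lambda>j. v j t) i) (at t within T)"
    if "t \<in> T" "i \<in> {1..n}" for t i
    using bspec[OF bspec[OF va that(1)] that(2)] by (rule conjunct1, rule conjunct2)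
  \<comment> \<open>An interval with two points has no isolated point, so derivatives within it are unique.\<close>
  have nb: "at t within T \<noteq> bot" if "t \<in> T" for t
  proof -
    have "t islimpt T"
      using T that by (intro connected_imp_perfect) (auto simp: is_interval_connected)
    then show ?thesis by (simp add: trivial_limit_within)
  qed
  define A where "A j = curved_acceleration \<kappa> n m (\<lambda>j. q j t) (\<lambda>j. v j t) j" for j
  have rot: "torque (q j t) (A j) = torque (q i t) (A i)" if j: "j \<in> {1..n}" for j
  proof -
    let ?R = "rotate_xy (\<alpha> j - \<alpha> i)"
    have qR: "q j s = ?R (q i s)" if "s \<in> T" for s
      using that i j by (simp add: q rotate_xy_vertex)
    have vR: "v j s = ?R (v i s)" if s: "s \<in> T" for s
    proof -
      have "((\<lambda>s. ?R (q i s)) has_vector_derivative ?R (v i s)) (at s within T)"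
        by (rule bounded_linear.has_vector_derivative[OF bounded_linear_rotate_xy v[OF s i]])
      then have "(q j has_vector_derivative ?R (v i s)) (at s within T)"
        by (rule has_vector_derivative_transform[OF s _, rotated]) (simp add: qR)
      from vector_derivative_unique_within[OF nb[OF s] v[OF s j] this] show ?thesis .
    qed
    have "((\<lambda>s. ?R (v i s)) has_vector_derivative ?R (A i)) (at t within T)"
      unfolding A_def
      by (rule bounded_linear.has_vector_derivative[OF bounded_linear_rotate_xy a[OF t i]])
    then have "(v j has_vector_derivative ?R (A i)) (at t within T)"
      by (rule has_vector_derivative_transform[OF t _, rotated]) (simp add: vR)
    from vector_derivative_unique_within[OF nb[OF t] a[OF t j] this]
    have "A j = ?R (A i)" by (simp add: A_def)
    then show ?thesis by (simp add: qR[OF t] torque_rotate_xy)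
  qed
  \<comment> \<open>The torque of \<open>j\<close> on \<open>i\<close> without the factor \<open>m j\<close>.\<close>
  define K where "K i j = \<bar>\<kappa>\<bar> powr (3 / 2) / force_denominator \<kappa> (q i t) (q j t)
      * torque (q i t) (q j t)" for i j
  have K: "torque (q j t) (A j) = (\<Sum>l\<in>{1..n} - {j}. m l * K j l)" for j
    using torque_curved_acceleration[of "\<lambda>j. q j t"] by (simp add: A_def K_def mult.assoc)
  have antisym: "K i j = - K j i" for i j
  proof -
    have "torque (q i t) (q j t) = - torque (q j t) (q i t)"
      by (simp add: torque_def)
    moreover have "force_denominator \<kappa> (q i t) (q j t) = force_denominator \<kappa> (q j t) (q i t)"
      by (simp add: force_denominator_def odot_def mult.commute)
    ultimately show ?thesis by (simp add: K_def)
  qed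
  have diag: "K j j = 0" for j by (simp add: K_def torque_def)
  have full: "(\<Sum>l\<in>{1..n} - {j}. m l * K j l) = (\<Sum>l\<in>{1..n}. m l * K j l)" for j
    using diag by (intro sum.mono_neutral_left) auto
  define S where "S = (\<Sum>j\<in>{1..n}. \<Sum>l\<in>{1..n}. m j * m l * K j l)"
  have "S = (\<Sum>l\<in>{1..n}. \<Sum>j\<in>{1..n}. m j * m l * K j l)"
    unfolding S_def by (rule sum.swap)
  also have "\<dots> = (\<Sum>l\<in>{1..n}. \<Sum>j\<in>{1..n}. - (m l * m j * K l j))"
    by (intro sum.cong refl, subst antisym) simp
  also have "\<dots> = - S" by (simp add: S_def sum_negf)
  finally have "S = 0" by simp
  moreover have "S = (\<Sum>j\<in>{1..n}. m j * torque (q j t) (A j))"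
    unfolding S_def K full sum_distrib_left by (simp only: mult.assoc)
  moreover have "\<dots> = (\<Sum>j\<in>{1..n}. m j) * torque (q i t) (A i)"
    unfolding sum_distrib_right by (intro sum.cong refl) (simp only: rot)
  moreover have "(\<Sum>j\<in>{1..n}. m j) > 0"
    using m i by (intro sum_pos) auto
  ultimately have "torque (q i t) (A i) = 0" by simp
  then have "(\<Sum>l\<in>{1..n} - {i}. m l * K i l) = 0" by (simp add: K)
  also have "(\<Sum>l\<in>{1..n} - {i}. m l * K i l) = \<bar>\<kappa>\<bar> powr (3 / 2) * (r t)\<^sup>2 *
      (\<Sum>j\<in>{1..n} - {i}. m j * sin (\<alpha> j - \<alpha> i) / force_denominator \<kappa> (q i t) (q j t))"
    unfolding sum_distrib_left
    by (intro sum.cong refl) (use i t in \<open>simp add: K_def q torque_vertices\<close>)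
  finally show ?thesis using k r0 by simp
qed

text \<open>On the surface, \<open>\<kappa> (a \<odot> b) = 1 - \<kappa> r\<^sup>2 d\<close> for two vertices, and \<open>1 - (1 - x)\<^sup>2 = x (2 - x)\<close>. The second
  factor is nonnegative: for \<open>\<kappa> < 0\<close> clearly, and on the sphere because \<open>\<kappa> r\<^sup>2 \<le> 1\<close> and \<open>d \<le> 2\<close>.\<close>

lemma force_denominator_vertices:
  fixes \<kappa> r z \<phi> \<psi> :: real
  assumes k: "\<kappa> \<noteq> 0" and z: "z\<^sup>2 = curv_sign \<kappa> * inverse \<kappa> - curv_sign \<kappa> * r\<^sup>2"
  defines "d \<equiv> 1 - cos (\<psi> - \<phi>)"
  shows "force_denominator \<kappa> (vector [r * cos \<phi>, r * sin \<phi>, z]) (vector [r * cos \<psi>, r * sin \<psi>, z])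
      = (\<bar>\<kappa>\<bar> * r\<^sup>2 * d) powr (3 / 2) * (2 - r\<^sup>2 * (\<kappa> * d)) powr (3 / 2)"
    and "0 \<le> 2 - r\<^sup>2 * (\<kappa> * d)"
proof -
  have s: "curv_sign \<kappa> * curv_sign \<kappa> = 1" and sk: "curv_sign \<kappa> * \<kappa> = \<bar>\<kappa>\<bar>"
    by (auto simp: curv_sign_def)
  have d: "0 \<le> d" "d \<le> 2" using cos_ge_minus_one[of "\<psi> - \<phi>"] by (auto simp: d_def)
  have z2: "curv_sign \<kappa> * (z * z) = inverse \<kappa> - r\<^sup>2"
    using z s by (simp add: power2_eq_square right_diff_distrib flip: mult.assoc)
  have kz: "\<kappa> * (curv_sign \<kappa> * (z * z)) = 1 - \<kappa> * r\<^sup>2"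
    using k by (simp add: z2 right_diff_distrib)
  have "odot \<kappa> (vector [r * cos \<phi>, r * sin \<phi>, z]) (vector [r * cos \<psi>, r * sin \<psi>, z])
      = r\<^sup>2 * cos (\<psi> - \<phi>) + curv_sign \<kappa> * (z * z)"
    by (simp add: odot_def cos_diff power2_eq_square algebra_simps)
  then have o: "\<kappa> * odot \<kappa> (vector [r * cos \<phi>, r * sin \<phi>, z]) (vector [r * cos \<psi>, r * sin \<psi>, z])
      = 1 - \<kappa> * r\<^sup>2 * d"
    by (simp only: distrib_left kz) (simp add: d_def algebra_simps)
  show nn: "0 \<le> 2 - r\<^sup>2 * (\<kappa> * d)"
  proof (cases "\<kappa> > 0")
    case True
    then have "0 \<le> inverse \<kappa> - r\<^sup>2" using z by (simp add: curv_sign_def) (metis diff_ge_0_iff_ge zero_le_power2)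
    then have "r\<^sup>2 * \<kappa> \<le> 1" using True by (simp add: field_simps)
    then have "r\<^sup>2 * \<kappa> * d \<le> 1 * 2" using d True by (intro mult_mono) auto
    then show ?thesis by (simp add: mult.assoc)
  next
    case False
    then have "r\<^sup>2 * (\<kappa> * d) \<le> 0" using d by (intro mult_nonneg_nonpos mult_nonpos_nonneg) auto
    then show ?thesis by simp
  qed
  have "curv_sign \<kappa> - curv_sign \<kappa> * (1 - \<kappa> * r\<^sup>2 * d)\<^sup>2
      = (curv_sign \<kappa> * \<kappa>) * r\<^sup>2 * d * (2 - r\<^sup>2 * (\<kappa> * d))"
    by (simp add: power2_eq_square algebra_simps)
  then show "force_denominator \<kappa> (vector [r * cos \<phi>, r * sin \<phi>, z]) (vector [r * cos \<psi>, r * sin \<psi>, z])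
      = (\<bar>\<kappa>\<bar> * r\<^sup>2 * d) powr (3 / 2) * (2 - r\<^sup>2 * (\<kappa> * d)) powr (3 / 2)"
    using nn d by (simp add: force_denominator_def o sk powr_mult)
qed

section \<open>Balance at each distance\<close>

text \<open>By \<open>z\<^sup>2 = \<sigma> / \<kappa> - \<sigma> r\<^sup>2\<close>, constant \<open>r\<^sup>2\<close> would leave at most two values for \<open>z\<close>, and a continuous
  function on an interval with finitely many values is constant. Continuity of \<open>z\<close> and \<open>r\<^sup>2\<close> comes from
  the coordinates of the first particle.\<close>

lemma nonconstant_height_imp_size_covers_interval:
  assumes orbit: "polygonal_homographic_orbit \<kappa> n m T q r \<omega> z \<alpha>"
    and n: "n \<ge> 1" and nonconst: "\<not> z constant_on T"
  shows "\<exists>a b. 0 \<le> a \<and> a < b \<and> (\<forall>\<rho>. a < \<rho> \<and> \<rho> < b \<longrightarrow> (\<exists>t\<in>T. (r t)\<^sup>2 = \<rho>))"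
proof -
  from orbit have sol: "curved_nbody_solution \<kappa> n m T q"
    and q: "\<And>t i. t \<in> T \<Longrightarrow> i \<in> {1..n} \<Longrightarrow>
        q i t = vector [r t * cos (\<omega> t + \<alpha> i), r t * sin (\<omega> t + \<alpha> i), z t]"
    and z: "\<And>t. t \<in> T \<Longrightarrow> (z t)\<^sup>2 = curv_sign \<kappa> * inverse \<kappa> - curv_sign \<kappa> * (r t)\<^sup>2"
    by (auto simp: polygonal_homographic_orbit_def)
  from sol have T: "is_interval T"
    and diff: "\<And>i. i \<in> {1..n} \<Longrightarrow> \<exists>v. \<forall>t\<in>T. (q i has_vector_derivative v t) (at t within T)"
    unfolding curved_nbody_solution_def by blast+
  have conn: "connected T" using T by (simp add: is_interval_connected)
  have one: "1 \<in> {1..n}" using n by simp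
  have "continuous_on T (q 1)"
    unfolding continuous_on_eq_continuous_within
    using diff[OF one] has_vector_derivative_continuous by blast
  then have "continuous_on T (\<lambda>t. q 1 t $ 3)"
    and "continuous_on T (\<lambda>t. (q 1 t $ 1)\<^sup>2 + (q 1 t $ 2)\<^sup>2)"
    by (auto intro!: continuous_intros)
  moreover have "(r t * cos x)\<^sup>2 + (r t * sin x)\<^sup>2 = (r t)\<^sup>2" for t x
    by (simp add: power_mult_distrib flip: distrib_left)
  ultimately have zcont: "continuous_on T z" and rcont: "continuous_on T (\<lambda>t. (r t)\<^sup>2)"
    using one by (auto simp: q cong: continuous_on_cong)
  have "\<not> (\<lambda>t. (r t)\<^sup>2) constant_on T"
  proof
    assume "(\<lambda>t. (r t)\<^sup>2) constant_on T"
    then obtain c where "\<forall>t\<in>T. (r t)\<^sup>2 = c" by (auto simp: constant_on_def)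
    then obtain c' where c': "\<And>t. t \<in> T \<Longrightarrow> (z t)\<^sup>2 = c'" using z by simp
    have "z t = sqrt c' \<or> z t = - sqrt c'" if "t \<in> T" for t
    proof -
      have "sqrt c' = \<bar>z t\<bar>" using c'[OF that] by (metis real_sqrt_abs)
      then show ?thesis by linarith
    qed
    then have "z ` T \<subseteq> {sqrt c', - sqrt c'}" by blast
    then have "finite (z ` T)" by (rule finite_subset) simp
    from continuous_finite_range_constant[OF conn zcont this] nonconst show False by simp
  qed
  then obtain s t where st: "s \<in> T" "t \<in> T" "(r s)\<^sup>2 < (r t)\<^sup>2"
  proof -
    assume "\<not> (\<lambda>t. (r t)\<^sup>2) constant_on T"
    then obtain s t where "s \<in> T" "t \<in> T" "(r s)\<^sup>2 \<noteq> (r t)\<^sup>2"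
      unfolding constant_on_def by blast
    then show thesis using that[of s t] that[of t s] by linarith
  qed
  define a b where "a = (r s)\<^sup>2" and "b = (r t)\<^sup>2"
  have ab: "a < b" using st by (simp add: a_def b_def)
  have hit: "\<exists>u\<in>T. (r u)\<^sup>2 = \<rho>" if "a < \<rho>" "\<rho> < b" for \<rho>
  proof -
    have "connected ((\<lambda>t. (r t)\<^sup>2) ` T)" using conn rcont by (rule connected_continuous_image[rotated])
    from connectedD_interval[OF this imageI[OF st(1)] imageI[OF st(2)], of \<rho>]
    have "\<rho> \<in> (\<lambda>t. (r t)\<^sup>2) ` T" using that by (simp add: a_def b_def)
    then show ?thesis by auto
  qed
  have "0 \<le> a" by (simp add: a_def)
  with ab hit show ?thesis by blast
qed

text \<open>Linear independence applied to the torque identity, with coefficients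
  \<open>m\<^sub>k sin (\<alpha>\<^sub>k - \<alpha>\<^sub>i) d\<^sub>k powr (- 3/2)\<close> and slopes \<open>\<kappa> d\<^sub>k\<close>. Positivity of the affine functions is the
  nonvanishing of the denominators.\<close>

lemma torque_balances_at_each_distance:
  assumes orbit: "polygonal_homographic_orbit \<kappa> n m T q r \<omega> z \<alpha>"
    and k0: "\<kappa> \<noteq> 0" and m: "\<forall>i\<in>{1..n}. m i > 0" and i: "i \<in> {1..n}"
    and a0: "0 \<le> a" and ab: "a < b"
    and hit: "\<And>\<rho>. a < \<rho> \<Longrightarrow> \<rho> < b \<Longrightarrow> \<exists>t\<in>T. (r t)\<^sup>2 = \<rho>"
    and j: "j \<in> {1..n} - {i}"
  shows "(\<Sum>k\<in>{k\<in>{1..n} - {i}. cos (\<alpha> k - \<alpha> i) = cos (\<alpha> j - \<alpha> i)}. m k * sin (\<alpha> k - \<alpha> i)) = 0"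
proof -
  from orbit have sol: "curved_nbody_solution \<kappa> n m T q"
    and q: "\<And>t i. t \<in> T \<Longrightarrow> i \<in> {1..n} \<Longrightarrow>
        q i t = vector [r t * cos (\<omega> t + \<alpha> i), r t * sin (\<omega> t + \<alpha> i), z t]"
    and z: "\<And>t. t \<in> T \<Longrightarrow> (z t)\<^sup>2 = curv_sign \<kappa> * inverse \<kappa> - curv_sign \<kappa> * (r t)\<^sup>2"
    by (auto simp: polygonal_homographic_orbit_def)
  from sol have den: "\<And>t i j. t \<in> T \<Longrightarrow> i \<in> {1..n} \<Longrightarrow> j \<in> {1..n} - {i} \<Longrightarrow>
        force_denominator \<kappa> (q i t) (q j t) \<noteq> 0"
    unfolding curved_nbody_solution_def by blast
  define d where "d k = 1 - cos (\<alpha> k - \<alpha> i)" for k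
  let ?J = "{1..n} - {i}"
  have D: "force_denominator \<kappa> (q i u) (q k u)
        = (\<bar>\<kappa>\<bar> * (r u)\<^sup>2 * d k) powr (3 / 2) * (2 - (r u)\<^sup>2 * (\<kappa> * d k)) powr (3 / 2)"
    "0 \<le> 2 - (r u)\<^sup>2 * (\<kappa> * d k)" if "u \<in> T" "k \<in> {1..n}" for u k
    using force_denominator_vertices[OF k0 z[OF that(1)],
        where \<phi> = "\<omega> u + \<alpha> i" and \<psi> = "\<omega> u + \<alpha> k"] that i
    by (simp_all add: q d_def)
  have basepos: "2 - \<rho> * (\<kappa> * d k) > 0" and dpos: "d k > 0"
    if "k \<in> ?J" "a < \<rho>" "\<rho> < b" for k \<rho>
  proof -
    from hit[OF that(2,3)] obtain u where u: "u \<in> T" "(r u)\<^sup>2 = \<rho>" by blast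
    have "force_denominator \<kappa> (q i u) (q k u) \<noteq> 0" using den[OF u(1) i that(1)] .
    then have "d k \<noteq> 0" "2 - \<rho> * (\<kappa> * d k) \<noteq> 0" using D(1)[OF u(1)] that u(2) by auto
    then show "2 - \<rho> * (\<kappa> * d k) > 0" "d k > 0"
      using D(2)[OF u(1)] that u(2) by (force simp: d_def less_le)+
  qed
  have "(\<Sum>k\<in>{k\<in>?J. \<kappa> * d k = \<kappa> * d j}. m k * sin (\<alpha> k - \<alpha> i) * d k powr (- (3 / 2))) = 0"
  proof (rule shifted_powers_independent[of ?J a b 2 "- (3 / 2)"])
    fix \<rho> assume \<rho>: "a < \<rho>" "\<rho> < b"
    from hit[OF \<rho>] obtain u where u: "u \<in> T" "(r u)\<^sup>2 = \<rho>" by blast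
    have "r u \<noteq> 0" using u \<rho> a0 by auto
    have "0 = (\<Sum>k\<in>?J. m k * sin (\<alpha> k - \<alpha> i) / force_denominator \<kappa> (q i u) (q k u))"
      using torque_zero[OF orbit m k0 u(1) i \<open>r u \<noteq> 0\<close>] by simp
    also have "\<dots> = (\<Sum>k\<in>?J. (\<bar>\<kappa>\<bar> * \<rho>) powr (- (3 / 2)) *
        (m k * sin (\<alpha> k - \<alpha> i) * d k powr (- (3 / 2)) * (2 - \<rho> * (\<kappa> * d k)) powr (- (3 / 2))))"
    proof (intro sum.cong refl)
      fix k assume k: "k \<in> ?J"
      have "force_denominator \<kappa> (q i u) (q k u) =
          (\<bar>\<kappa>\<bar> * \<rho>) powr (3 / 2) * d k powr (3 / 2) * (2 - \<rho> * (\<kappa> * d k)) powr (3 / 2)"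
        using D(1)[OF u(1), of k] k u(2) \<rho> a0 dpos[OF k \<rho>] by (simp add: powr_mult)
      then show "m k * sin (\<alpha> k - \<alpha> i) / force_denominator \<kappa> (q i u) (q k u) =
          (\<bar>\<kappa>\<bar> * \<rho>) powr (- (3 / 2)) * (m k * sin (\<alpha> k - \<alpha> i) * d k powr (- (3 / 2)) *
            (2 - \<rho> * (\<kappa> * d k)) powr (- (3 / 2)))"
        by (simp only: powr_minus divide_inverse inverse_mult_distrib mult_ac)
    qed
    finally have "(\<bar>\<kappa>\<bar> * \<rho>) powr (- (3 / 2)) * (\<Sum>k\<in>?J. m k * sin (\<alpha> k - \<alpha> i) * d k powr (- (3 / 2)) *
        (2 - \<rho> * (\<kappa> * d k)) powr (- (3 / 2))) = 0"
      by (simp add: sum_distrib_left)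
    then show "(\<Sum>k\<in>?J. m k * sin (\<alpha> k - \<alpha> i) * d k powr (- (3 / 2)) *
        (2 - \<rho> * (\<kappa> * d k)) powr (- (3 / 2))) = 0"
      using \<rho> a0 k0 by simp
  qed (use ab basepos in auto)
  also have "{k\<in>?J. \<kappa> * d k = \<kappa> * d j} = {k\<in>?J. cos (\<alpha> k - \<alpha> i) = cos (\<alpha> j - \<alpha> i)}"
    using k0 by (auto simp: d_def)
  also have "(\<Sum>k\<in>{k\<in>?J. cos (\<alpha> k - \<alpha> i) = cos (\<alpha> j - \<alpha> i)}. m k * sin (\<alpha> k - \<alpha> i) * d k powr (- (3 / 2)))
      = d j powr (- (3 / 2)) *
        (\<Sum>k\<in>{k\<in>?J. cos (\<alpha> k - \<alpha> i) = cos (\<alpha> j - \<alpha> i)}. m k * sin (\<alpha> k - \<alpha> i))"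
    unfolding sum_distrib_left by (intro sum.cong refl) (simp add: d_def)
  finally have "d j powr (- (3 / 2)) = 0 \<or>
      (\<Sum>k\<in>{k\<in>?J. cos (\<alpha> k - \<alpha> i) = cos (\<alpha> j - \<alpha> i)}. m k * sin (\<alpha> k - \<alpha> i)) = 0" by simp
  moreover have "d j > 0" using dpos[OF j, of "(a + b) / 2"] ab by simp
  ultimately show ?thesis by simp
qed

section \<open>Mirror symmetric polygons are regular\<close>

text \<open>Equal cosines leave only the sines \<open>s\<close> and \<open>- s\<close>, where \<open>s = sin (\<alpha> j - \<alpha> i)\<close>. Without a vertex on
  the other side the sum would have positive terms only.\<close>

lemma balanced_vertices_imp_mirror:
  fixes m \<alpha> :: "nat \<Rightarrow> real"
  assumes m: "\<forall>i\<in>{1..n}. m i > 0" and i: "i \<in> {1..n}" and j: "j \<in> {1..n}"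
    and bal: "(\<Sum>k\<in>{k\<in>{1..n} - {i}. cos (\<alpha> k - \<alpha> i) = cos (\<alpha> j - \<alpha> i)}. m k * sin (\<alpha> k - \<alpha> i)) = 0"
    and pos: "sin (\<alpha> j - \<alpha> i) > 0"
  shows "\<exists>k\<in>{1..n}. cos (\<alpha> k - \<alpha> i) = cos (\<alpha> j - \<alpha> i) \<and> sin (\<alpha> k - \<alpha> i) = - sin (\<alpha> j - \<alpha> i)"
proof (rule ccontr)
  let ?F = "{k\<in>{1..n} - {i}. cos (\<alpha> k - \<alpha> i) = cos (\<alpha> j - \<alpha> i)}"
  assume no: "\<not> ?thesis"
  have "sin (\<alpha> k - \<alpha> i) = sin (\<alpha> j - \<alpha> i)" if "k \<in> ?F" for k
  proof -
    have "cos (\<alpha> k - \<alpha> i) = cos (\<alpha> j - \<alpha> i)" using that by simp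
    then have "(sin (\<alpha> k - \<alpha> i))\<^sup>2 = (sin (\<alpha> j - \<alpha> i))\<^sup>2"
      by (metis sin_squared_eq)
    then show ?thesis using no that by (auto simp: power2_eq_iff)
  qed
  then have "m k * sin (\<alpha> k - \<alpha> i) > 0" if "k \<in> ?F" for k using that pos m by auto
  moreover have "j \<in> ?F" using j pos by auto
  ultimately have "(\<Sum>k\<in>?F. m k * sin (\<alpha> k - \<alpha> i)) > 0" by (intro sum_pos) auto
  then show False using bal by simp
qed

text \<open>Mirroring is used only to compare neighbouring gaps: if the gap after a vertex \<open>p\<close> is at most the
  average, then the mirror image of the vertex following \<open>p\<close> cannot lie strictly inside the gap before
  \<open>p\<close>, so that gap is at most the average as well.\<close>

lemma mirror_vertices_imp_regular:
  assumes n: "n \<ge> 3" and range: "\<And>i. i \<in> {1..n} \<Longrightarrow> 0 \<le> \<alpha> i \<and> \<alpha> i < 2 * pi"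
    and mono: "strict_mono_on {1..n} \<alpha>"
    and mirror: "\<And>i j. i \<in> {1..n} \<Longrightarrow> j \<in> {1..n} \<Longrightarrow> sin (\<alpha> j - \<alpha> i) > 0 \<Longrightarrow>
       \<exists>k\<in>{1..n}. cos (\<alpha> k - \<alpha> i) = cos (\<alpha> j - \<alpha> i) \<and> sin (\<alpha> k - \<alpha> i) = - sin (\<alpha> j - \<alpha> i)"
  shows "regular_polygon n \<alpha>"
proof -
  define nxt where "nxt i = (if i = n then 1 else i + 1)" for i
  define gap where "gap i = (if i = n then \<alpha> 1 + 2 * pi else \<alpha> (i + 1)) - \<alpha> i" for i
  define c where "c = 2 * pi / real n"
  have less: "\<alpha> i < \<alpha> j" if "i < j" "1 \<le> i" "j \<le> n" for i j
    using mono that by (auto simp: strict_mono_on_def)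
  have c: "c < pi" using n by (simp add: c_def field_simps)
  have gap_pos: "gap i > 0" if "i \<in> {1..n}" for i
    using that less[of i "i + 1"] range[of 1] range[of n] by (auto simp: gap_def)
  have gap_trig: "cos (\<alpha> (nxt i) - \<alpha> i) = cos (gap i)" "sin (\<alpha> (nxt i) - \<alpha> i) = sin (gap i)" for i
    by (auto simp: nxt_def gap_def cos_diff sin_diff cos_add sin_add)
  have gap_step: "gap (nxt i) > c" if i: "i \<in> {1..n}" and gi: "gap i > c" for i
  proof (rule ccontr)
    let ?p = "nxt i"
    assume "\<not> gap ?p > c"
    then have le: "gap ?p \<le> c" by simp
    have p: "?p \<in> {1..n}" "nxt ?p \<in> {1..n}" using i by (auto simp: nxt_def)
    have g: "0 < gap ?p" "gap ?p < pi" using gap_pos[OF p(1)] le c by auto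
    have "sin (\<alpha> (nxt ?p) - \<alpha> ?p) > 0" unfolding gap_trig using g by (rule sin_gt_zero)
    from mirror[OF p this] obtain k where k: "k \<in> {1..n}"
      and "cos (\<alpha> k - \<alpha> ?p) = cos (gap ?p)" "sin (\<alpha> k - \<alpha> ?p) = - sin (gap ?p)"
      unfolding gap_trig by blast
    then have "sin (\<alpha> k - \<alpha> ?p) = sin (- gap ?p) \<and> cos (\<alpha> k - \<alpha> ?p) = cos (- gap ?p)" by simp
    then obtain l :: int where l: "\<alpha> k - \<alpha> ?p = - gap ?p + 2 * pi * l"
      unfolding sin_cos_eq_iff by blast
    \<comment> \<open>All angles lie in \<open>[0, 2 \<pi>)\<close>, so the mirror image is found at \<open>\<alpha> ?p - gap ?p\<close>
      or one full turn later.\<close>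
    have "- 1 < real_of_int l" "real_of_int l < 2"
    proof -
      have "2 * pi * (- 1) < 2 * pi * l" "2 * pi * l < 2 * pi * 2"
        using l g range[OF k] range[OF p(1)] by linarith+
      then show "- 1 < real_of_int l" "real_of_int l < 2"
        using pi_gt_zero by (simp_all only: mult_less_cancel_left_pos)
    qed
    then have "l = 0 \<or> l = 1" by linarith
    then show False
    proof
      assume "l = 0"
      then have ak: "\<alpha> k = \<alpha> ?p - gap ?p" using l by simp
      then have "k < ?p" using g less[of ?p k] k p by (cases k ?p rule: linorder_cases) auto
      then have "i < n" "k \<le> i" using i k by (auto simp: nxt_def split: if_splits)
      then have "\<alpha> k \<le> \<alpha> i" using less[of k i] i k by (cases "k = i") auto
      moreover have "gap i = \<alpha> ?p - \<alpha> i" using \<open>i < n\<close> by (simp add: gap_def nxt_def)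
      ultimately show False using ak le gi by simp
    next
      assume "l = 1"
      then have ak: "\<alpha> k = \<alpha> ?p - gap ?p + 2 * pi" using l by simp
      show False
      proof (cases "i = n")
        case True
        then have "\<alpha> k > \<alpha> n" using ak le gi by (simp add: gap_def nxt_def)
        then show False using less[of k n] k by (cases "k = n") auto
      next
        case False
        then have "\<alpha> k > \<alpha> i + 2 * pi" using ak le gi by (simp add: gap_def nxt_def)
        then show False using range[OF i] range[OF k] by simp
      qed
    qed
  qed
  have telescope: "(\<Sum>i\<in>{1..<k}. \<alpha> (i + 1) - \<alpha> i) = \<alpha> k - \<alpha> 1" if "k \<ge> 1" for k
    using that sum_Suc_diff'[of 1 k \<alpha>] by simp
  have total: "(\<Sum>i\<in>{1..n}. gap i) = 2 * pi"
  proof -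
    have "{1..n} = insert n {1..<n}" using n by auto
    then have "(\<Sum>i\<in>{1..n}. gap i) = gap n + (\<Sum>i\<in>{1..<n}. gap i)" by simp
    also have "(\<Sum>i\<in>{1..<n}. gap i) = \<alpha> n - \<alpha> 1"
      using telescope[of n] n by (simp add: gap_def)
    finally show ?thesis by (simp add: gap_def)
  qed
  have csum: "(\<Sum>i\<in>{1..n}. c) = 2 * pi" using n by (simp add: c_def)
  \<comment> \<open>An excessive gap spreads upwards to the last index, then across the wrap-around to index 1,
    and from there to all indices.\<close>
  have up: "gap j > c" if "gap i > c" "1 \<le> i" "i \<le> j" "j \<le> n" for i j
    using that(3,4)
  proof (induction j rule: dec_induct)
    case base
    then show ?case using that by simp
  next
    case (step j)
    then show ?case using gap_step[of j] that
      by (simp add: nxt_def)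
  qed
  have le: "gap i \<le> c" if i: "i \<in> {1..n}" for i
  proof (rule ccontr)
    assume "\<not> gap i \<le> c"
    then have "gap n > c" using up[of i n] i by simp
    then have "gap 1 > c" using gap_step[of n] n by (simp add: nxt_def)
    then have "gap j > c" if "j \<in> {1..n}" for j using up[of 1 j] that by simp
    then have "(\<Sum>i\<in>{1..n}. c) < (\<Sum>i\<in>{1..n}. gap i)"
      using n by (intro sum_strict_mono) auto
    then show False using total csum by simp
  qed
  have "(\<Sum>i\<in>{1..n}. c - gap i) = 0" using total csum by (simp add: sum_subtractf)
  then have "\<forall>i\<in>{1..n}. c - gap i = 0"
    using le by (subst (asm) sum_nonneg_eq_0_iff) auto
  then show ?thesis by (simp add: regular_polygon_def gap_def c_def)
qed

section \<open>Nonexistence of irregular homographic orbits of varying height\<close>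

theorem theorem1p2:
  fixes \<kappa> :: real and n :: nat and m :: "nat \<Rightarrow> real"
  assumes "\<kappa> \<noteq> 0" and "n \<ge> 3" and "\<forall>i\<in>{1..n}. m i > 0"
  shows "\<not> (\<exists>T q r \<omega> z \<alpha>.
           polygonal_homographic_orbit \<kappa> n m T q r \<omega> z \<alpha> \<and>
           \<not> regular_polygon n \<alpha> \<and> \<not> z constant_on T)"
proof (clarify)
  fix T q r \<omega> z \<alpha>
  assume orbit: "polygonal_homographic_orbit \<kappa> n m T q r \<omega> z \<alpha>"
    and irregular: "\<not> regular_polygon n \<alpha>" and nonconst: "\<not> z constant_on T"
  have range: "\<And>i. i \<in> {1..n} \<Longrightarrow> 0 \<le> \<alpha> i \<and> \<alpha> i < 2 * pi"
    and mono: "strict_mono_on {1..n} \<alpha>"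
    using orbit by (auto simp: polygonal_homographic_orbit_def)
  obtain a b where ab: "0 \<le> a" "a < b"
    and hit: "\<And>\<rho>. a < \<rho> \<Longrightarrow> \<rho> < b \<Longrightarrow> \<exists>t\<in>T. (r t)\<^sup>2 = \<rho>"
    using nonconstant_height_imp_size_covers_interval[OF orbit _ nonconst] assms(2) by force
  have "regular_polygon n \<alpha>"
  proof (rule mirror_vertices_imp_regular[OF assms(2) range mono])
    fix i j
    assume i: "i \<in> {1..n}" and j: "j \<in> {1..n}" and pos: "sin (\<alpha> j - \<alpha> i) > 0"
    have "j \<in> {1..n} - {i}" using j pos by auto
    from balanced_vertices_imp_mirror[OF assms(3) i j
        torque_balances_at_each_distance[OF orbit assms(1,3) i ab hit this] pos]
    show "\<exists>k\<in>{1..n}. cos (\<alpha> k - \<alpha> i) = cos (\<alpha> j - \<alpha> i) \<and> sin (\<alpha> k - \<alpha> i) = - sin (\<alpha> j - \<alpha> i)" .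
  qed
  with irregular show False ..
qed

end
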